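(* Any subrack of a free rack is free. That is, let $X$ be a set, let $\mathrm{FR}(X)$ be the free rack on $X$, and let $R\subseteq \mathrm{FR}(X)$ be a subrack. Then $R$ is a free rack: there exists a subset $S\subseteq R$ such that for every rack $T$ and every function $\rho\colon S\to T$ there is a unique rack homomorphism $\overline{\rho}\colon R\to T$ whose restriction to $S$ is $\rho$.
   Context: A rack is a set $R$ equipped with two binary operations $\triangleright,\triangleright^{-1}$ such that for all $x,y,z\in R$: (R1) $(x\triangleright y)\triangleright z=(x\triangleright z)\triangleright(y\triangleright z)$ and $(x\triangleright^{-1}y)\triangleright^{-1}z=(x\triangleright^{-1}z)\triangleright^{-1}(y\triangleright^{-1}z)$; (R2) $(x\triangleright y)\triangleright^{-1}y=x=(x\triangleright^{-1}y)\triangleright y$. A rack homomorphism is a map preserving both operations. A subrack is a subset closed under both operations $\triangleright$ and $\triangleright^{-1}$ (the empty set is allowed, and it is the free rack on the empty set). The free rack on a set $X$ is a rack $\mathrm{FR}(X)$ together with an embedding $\varphi\colon X\to \mathrm{FR}(X)$ such that for every rack $T$ and every function $\rho\colon X\to T$ there is a unique rack homomorphism $\overline{\rho}\colon \mathrm{FR}(X)\to T$ with $\overline{\rho}\circ\varphi=\rho$. Concretely, $\mathrm{FR}(X)$ can be taken to be the set $X\times F(X)$, where $F(X)$ is the free group on $X$, with operations $$(a,u)\triangleright(b,v)=(a,uv^{-1}bv),\qquad (a,u)\triangleright^{-1}(b,v)=(a,uv^{-1}b^{-1}v)$$ for $a,b\in X$, $u,v\in F(X)$, and $\varphi(a)=(a,1)$.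 A rack is called free if it is isomorphic to $\mathrm{FR}(Y)$ for some set $Y$. *)

theory Defs
  imports "HOL-Algebra.Group"
begin

section \<open>Racks\<close>

record 'a rack = "'a partial_object" +
  rop :: "['a, 'a] \<Rightarrow> 'a" (infixl "\<triangleright>\<index>" 70)
  rinv :: "['a, 'a] \<Rightarrow> 'a" (infixl "\<triangleright>\<inverse>\<index>" 70)

locale rack =
  fixes R :: "('a, 'm) rack_scheme" (structure)
  assumes rop_closed: "\<lbrakk>x \<in> carrier R; y \<in> carrier R\<rbrakk> \<Longrightarrow> x \<triangleright> y \<in> carrier R"
    and rinv_closed: "\<lbrakk>x \<in> carrier R; y \<in> carrier R\<rbrakk> \<Longrightarrow> x \<triangleright>\<inverse> y \<in> carrier R"
    and rop_distrib: "\<lbrakk>x \<in> carrier R; y \<in> carrier R; z \<in> carrier R\<rbrakk>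
      \<Longrightarrow> (x \<triangleright> y) \<triangleright> z = (x \<triangleright> z) \<triangleright> (y \<triangleright> z)"
    and rinv_distrib: "\<lbrakk>x \<in> carrier R; y \<in> carrier R; z \<in> carrier R\<rbrakk>
      \<Longrightarrow> (x \<triangleright>\<inverse> y) \<triangleright>\<inverse> z = (x \<triangleright>\<inverse> z) \<triangleright>\<inverse> (y \<triangleright>\<inverse> z)"
    and rop_rinv: "\<lbrakk>x \<in> carrier R; y \<in> carrier R\<rbrakk> \<Longrightarrow> (x \<triangleright> y) \<triangleright>\<inverse> y = x"
    and rinv_rop: "\<lbrakk>x \<in> carrier R; y \<in> carrier R\<rbrakk> \<Longrightarrow> (x \<triangleright>\<inverse> y) \<triangleright> y = x"

text \<open>As with \<open>hom\<close> for groups, values outside the carrier are unconstrained.\<close>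

definition rack_hom :: "('a, 'm) rack_scheme \<Rightarrow> ('b, 'n) rack_scheme \<Rightarrow> ('a \<Rightarrow> 'b) set" where
  "rack_hom R T = {h \<in> carrier R \<rightarrow> carrier T. \<forall>x\<in>carrier R. \<forall>y\<in>carrier R.
     h (x \<triangleright>\<^bsub>R\<^esub> y) = h x \<triangleright>\<^bsub>T\<^esub> h y \<and> h (x \<triangleright>\<inverse>\<^bsub>R\<^esub> y) = h x \<triangleright>\<inverse>\<^bsub>T\<^esub> h y}"

definition rack_iso :: "('a, 'm) rack_scheme \<Rightarrow> ('b, 'n) rack_scheme \<Rightarrow> ('a \<Rightarrow> 'b) set" where
  "rack_iso R T = {h \<in> rack_hom R T. bij_betw h (carrier R) (carrier T)}"

definition subrack :: "'a set \<Rightarrow> ('a, 'm) rack_scheme \<Rightarrow> bool" where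
  "subrack S R \<longleftrightarrow> S \<subseteq> carrier R \<and>
     (\<forall>x\<in>S. \<forall>y\<in>S. x \<triangleright>\<^bsub>R\<^esub> y \<in> S \<and> x \<triangleright>\<inverse>\<^bsub>R\<^esub> y \<in> S)"


section \<open>The free group on a set\<close>

text \<open>Elements are reduced words; the letter \<open>(a, True)\<close> stands for \<open>a\<close> and
  \<open>(a, False)\<close> for its inverse.\<close>

definition flip :: "'a \<times> bool \<Rightarrow> 'a \<times> bool" where
  "flip l = (fst l, \<not> snd l)"

fun reduced :: "('a \<times> bool) list \<Rightarrow> bool" where
  "reduced (l # m # w) \<longleftrightarrow> m \<noteq> flip l \<and> reduced (m # w)"
| "reduced _ \<longleftrightarrow> True"

fun push :: "'a \<times> bool \<Rightarrow> ('a \<times> bool) list \<Rightarrow> ('a \<times> bool) list" where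
  "push l [] = [l]"
| "push l (m # w) = (if m = flip l then w else l # m # w)"

text \<open>For reduced \<open>v\<close>, \<open>foldr push u v\<close> is the reduced form of \<open>u @ v\<close>.\<close>

definition free_group :: "'a set \<Rightarrow> ('a \<times> bool) list monoid" where
  "free_group X = \<lparr>carrier = {w. reduced w \<and> fst ` set w \<subseteq> X},
     mult = (\<lambda>u v. foldr push u v), one = []\<rparr>"

definition free_gen :: "'a \<Rightarrow> ('a \<times> bool) list" where
  "free_gen a = [(a, True)]"

lemma flip_flip [simp]: "flip (flip l) = l"
  by (simp add: flip_def)

lemma fst_flip [simp]: "fst (flip l) = fst l"
  by (simp add: flip_def)

lemma reduced_tl: "reduced (l # w) \<Longrightarrow> reduced w"
  by (cases w) auto

lemma reduced_push: "reduced w \<Longrightarrow> reduced (push l w)"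
  by (cases w) (auto dest: reduced_tl)

lemma push_flip: "reduced w \<Longrightarrow> push (flip l) (push l w) = w"
proof (cases w)
  case (Cons m v)
  assume "reduced w"
  then show ?thesis using Cons by (cases v) auto
qed simp

lemma reduced_foldr_push: "reduced v \<Longrightarrow> reduced (foldr push u v)"
  by (induction u) (auto intro: reduced_push)

lemma letters_push: "fst ` set (push l w) \<subseteq> insert (fst l) (fst ` set w)"
  by (cases w) auto

lemma letters_foldr_push: "fst ` set (foldr push u v) \<subseteq> fst ` set u \<union> fst ` set v"
proof (induction u)
  case (Cons l u)
  have "fst ` set (foldr push (l # u) v) \<subseteq> insert (fst l) (fst ` set (foldr push u v))"
    using letters_push[of l "foldr push u v"] by simp
  also have "\<dots> \<subseteq> insert (fst l) (fst ` set u \<union> fst ` set v)"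
    using Cons.IH by (rule insert_mono)
  finally show ?case by simp
qed simp

lemma foldr_push_push:
  assumes "reduced w"
  shows "foldr push (push l v) w = push l (foldr push v w)"
proof (cases v)
  case (Cons m u)
  have "push l (push (flip l) (foldr push u w)) = foldr push u w"
    using push_flip[of "foldr push u w" "flip l"] reduced_foldr_push[OF assms] by simp
  then show ?thesis using Cons by auto
qed simp

lemma foldr_push_assoc:
  "reduced w \<Longrightarrow> foldr push (foldr push u v) w = foldr push u (foldr push v w)"
  by (induction u) (auto simp: foldr_push_push)

lemma foldr_push_Nil: "reduced w \<Longrightarrow> foldr push w [] = w"
proof (induction w)
  case (Cons l w)
  then show ?case by (cases w) simp_all
qed simp

lemma foldr_push_inverse:
  "reduced w \<Longrightarrow> foldr push (rev (map flip u)) (foldr push u w) = w"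
  by (induction u) (auto simp: push_flip reduced_foldr_push)

lemma group_free_group: "group (free_group X)"
proof (rule groupI)
  fix u assume u: "u \<in> carrier (free_group X)"
  let ?v = "foldr push (rev (map flip u)) []"
  have "foldr push ?v u = []"
    using u foldr_push_assoc[of u "rev (map flip u)" "[]"] foldr_push_inverse[of "[]" u]
    by (simp add: free_group_def foldr_push_Nil)
  moreover have "fst ` set ?v \<subseteq> X"
    using letters_foldr_push[of "rev (map flip u)" "[]"] u
    by (simp add: free_group_def image_image order_trans)
  then have "?v \<in> carrier (free_group X)"
    by (simp add: free_group_def reduced_foldr_push)
  ultimately show "\<exists>v\<in>carrier (free_group X). v \<otimes>\<^bsub>free_group X\<^esub> u = \<one>\<^bsub>free_group X\<^esub>"
    by (auto simp: free_group_def)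
next
  fix u v assume "u \<in> carrier (free_group X)" "v \<in> carrier (free_group X)"
  then show "u \<otimes>\<^bsub>free_group X\<^esub> v \<in> carrier (free_group X)"
    using order_trans[OF letters_foldr_push[of u v], of X]
    by (simp add: free_group_def reduced_foldr_push)
qed (auto simp: free_group_def foldr_push_assoc)


section \<open>The free rack on a set\<close>

definition FR :: "'a set \<Rightarrow> ('a \<times> ('a \<times> bool) list) rack" where
  "FR X = \<lparr>carrier = X \<times> carrier (free_group X),
     rop = (\<lambda>(a, u) (b, v).
       (a, u \<otimes>\<^bsub>free_group X\<^esub> inv\<^bsub>free_group X\<^esub> v
             \<otimes>\<^bsub>free_group X\<^esub> free_gen b \<otimes>\<^bsub>free_group X\<^esub> v)),
     rinv = (\<lambda>(a, u) (b, v).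
       (a, u \<otimes>\<^bsub>free_group X\<^esub> inv\<^bsub>free_group X\<^esub> v
             \<otimes>\<^bsub>free_group X\<^esub> inv\<^bsub>free_group X\<^esub> free_gen b \<otimes>\<^bsub>free_group X\<^esub> v))\<rparr>"

definition FR_gen :: "'a set \<Rightarrow> 'a \<Rightarrow> 'a \<times> ('a \<times> bool) list" where
  "FR_gen X a = (a, \<one>\<^bsub>free_group X\<^esub>)"

lemma rack_FR: "rack (FR X)"
proof -
  let ?G = "free_group X"
  interpret G: group ?G by (rule group_free_group)
  have gen: "free_gen a \<in> carrier ?G" if "a \<in> X" for a
    using that by (simp add: free_group_def free_gen_def)
  have cancel: "x \<otimes>\<^bsub>?G\<^esub> (inv\<^bsub>?G\<^esub> x \<otimes>\<^bsub>?G\<^esub> y) = y" "inv\<^bsub>?G\<^esub> x \<otimes>\<^bsub>?G\<^esub> (x \<otimes>\<^bsub>?G\<^esub> y) = y"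
    if "x \<in> carrier ?G" "y \<in> carrier ?G" for x y
    using that by (simp_all add: G.m_assoc[symmetric])
  show ?thesis
    by unfold_locales
      (auto simp: FR_def gen G.m_assoc G.inv_mult_group cancel)
qed

text \<open>\<open>S\<close> is a basis of \<open>R\<close> if \<open>R\<close> is isomorphic to \<open>FR S\<close> by an isomorphism that
  identifies the standard generators with the elements of \<open>S\<close>.  Unlike the universal
  property, which in HOL can only be tested against racks over one type at a time, this does
  not depend on a target type.\<close>

definition rack_basis :: "'a set \<Rightarrow> ('a, 'm) rack_scheme \<Rightarrow> bool" where
  "rack_basis S R \<longleftrightarrow> S \<subseteq> carrier R \<and> (\<exists>h\<in>rack_iso (FR S) R. \<forall>s\<in>S. h (FR_gen S s) = s)"

end

(* Call an element (b, v) of a subrack R of FR X irreducible if the reduced word v has no suffix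
   c^e w with (c, w) in R and e = 1 or -1.  If v = y c^e w, then (b, yw) is obtained from (b, v)
   by acting with (c, w), so lies in R, and (b, v) is recovered from the shorter elements (b, yw)
   and (c, w); hence R is generated by its irreducible elements.  They generate freely: acting on
   an irreducible element by a nonempty reduced word in irreducibles whose last letter is (c, w)^e
   gives a group element whose reduced form ends in c^e w (as in Nielsen reduction, the central
   letters c^e of the conjugates w^-1 c^e w never cancel), and no irreducible element ends so. *)

theory Submission
  imports Defs "HOL-Library.Sublist"
begin

section \<open>Words acting on a rack\<close>

text \<open>The exponent is a Boolean, as in the letters of free-group words, so the letter
  \<open>(i, e)\<close> acts through \<open>rack_op R e\<close> and one argument covers both
  operations.\<close>

definition rack_op :: "('a, 'm) rack_scheme \<Rightarrow> bool \<Rightarrow> 'a \<Rightarrow> 'a \<Rightarrow> 'a" where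
  "rack_op R e x y = (if e then x \<triangleright>\<^bsub>R\<^esub> y else x \<triangleright>\<inverse>\<^bsub>R\<^esub> y)"

context rack
begin

lemma rack_op_closed: "\<lbrakk>x \<in> carrier R; y \<in> carrier R\<rbrakk> \<Longrightarrow> rack_op R e x y \<in> carrier R"
  by (simp add: rack_op_def rop_closed rinv_closed)

lemma rack_op_cancel:
  "\<lbrakk>x \<in> carrier R; y \<in> carrier R; e' = (\<not> e)\<rbrakk> \<Longrightarrow> rack_op R e (rack_op R e' x y) y = x"
  by (simp add: rack_op_def rop_rinv rinv_rop)

text \<open>Write \<open>x\<close> as
  \<open>(x \<triangleright>\<inverse> y) \<triangleright> y\<close>, distribute over
  \<open>z\<close>, and cancel the action of \<open>y \<triangleright> z\<close>. The next lemma is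
  the mirror image. With (R1), every element then acts in both directions by endomorphisms for both
  operations.\<close>

lemma rinv_rop_distrib:
  assumes "x \<in> carrier R" "y \<in> carrier R" "z \<in> carrier R"
  shows "(x \<triangleright>\<inverse> y) \<triangleright> z = (x \<triangleright> z) \<triangleright>\<inverse> (y \<triangleright> z)"
  using assms rop_distrib[of "x \<triangleright>\<inverse> y" y z]
  by (simp add: rop_closed rinv_closed rop_rinv rinv_rop)

lemma rop_rinv_distrib:
  assumes "x \<in> carrier R" "y \<in> carrier R" "z \<in> carrier R"
  shows "(x \<triangleright> y) \<triangleright>\<inverse> z = (x \<triangleright>\<inverse> z) \<triangleright> (y \<triangleright>\<inverse> z)"
proof -
  have "(x \<triangleright>\<inverse> z) = ((x \<triangleright> y) \<triangleright>\<inverse> z) \<triangleright>\<inverse> (y \<triangleright>\<inverse> z)"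
    using assms rinv_distrib[of "x \<triangleright> y" y z] by (simp add: rop_closed rop_rinv)
  then show ?thesis
    using assms by (simp add: rop_closed rinv_closed rinv_rop)
qed

lemma rack_op_distrib:
  "\<lbrakk>x \<in> carrier R; y \<in> carrier R; z \<in> carrier R\<rbrakk> \<Longrightarrow>
    rack_op R e (rack_op R e' x y) z = rack_op R e' (rack_op R e x z) (rack_op R e y z)"
  by (simp add: rack_op_def rop_distrib rinv_distrib rinv_rop_distrib rop_rinv_distrib)

lemma rack_subrack: "subrack S R \<Longrightarrow> rack (R\<lparr>carrier := S\<rparr>)"
  by (intro rack.intro)
    (auto simp: subrack_def subset_iff intro: rop_distrib rinv_distrib rop_rinv rinv_rop)

end

section \<open>Homomorphisms and isomorphisms of racks\<close>

lemma rack_hom_iff: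
  "h \<in> rack_hom R T \<longleftrightarrow> h \<in> carrier R \<rightarrow> carrier T \<and>
    (\<forall>x\<in>carrier R. \<forall>y\<in>carrier R. \<forall>e. h (rack_op R e x y) = rack_op T e (h x) (h y))"
  by (auto simp: rack_hom_def rack_op_def all_bool_eq)

lemma rack_homD:
  assumes "h \<in> rack_hom R T"
  shows rack_hom_closed: "x \<in> carrier R \<Longrightarrow> h x \<in> carrier T"
    and rack_hom_op: "\<lbrakk>x \<in> carrier R; y \<in> carrier R\<rbrakk>
      \<Longrightarrow> h (rack_op R e x y) = rack_op T e (h x) (h y)"
  using assms by (auto simp: rack_hom_iff)

lemma rack_hom_comp:
  "\<lbrakk>h \<in> rack_hom R T; k \<in> rack_hom T U\<rbrakk> \<Longrightarrow> k \<circ> h \<in> rack_hom R U"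
  by (auto simp: rack_hom_iff Pi_iff)

lemma rack_iso_inv:
  assumes "rack R" and h: "h \<in> rack_iso R T"
  shows "inv_into (carrier R) h \<in> rack_iso T R"
proof -
  interpret rack R by fact
  let ?g = "inv_into (carrier R) h"
  have hom: "h \<in> rack_hom R T" and bij: "bij_betw h (carrier R) (carrier T)"
    using h by (auto simp: rack_iso_def)
  have bij': "bij_betw ?g (carrier T) (carrier R)"
    using bij by (rule bij_betw_inv_into)
  have "?g (rack_op T e x y) = rack_op R e (?g x) (?g y)"
    if "x \<in> carrier T" "y \<in> carrier T" for x y e
  proof -
    have g: "?g x \<in> carrier R" "?g y \<in> carrier R"
      using that bij' by (auto simp: bij_betw_def)
    have "h (rack_op R e (?g x) (?g y)) = rack_op T e x y"
      using that g bij by (simp add: rack_hom_op[OF hom] bij_betw_inv_into_right)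
    then show ?thesis
      using bij_betw_inv_into_left[OF bij rack_op_closed[OF g, of e]] by simp
  qed
  then show ?thesis
    using bij' bij_betwE[OF bij'] by (auto simp: rack_iso_def rack_hom_iff)
qed

text \<open>A right action, reading the word from left to right. The index type is separate from the
  rack because the same words over \<open>S\<close> later act both on the subrack
  (\<open>\<rho> = id\<close>) and on its image in \<open>FR X\<close>
  (\<open>\<rho> = g\<close>).\<close>

definition rack_act :: "('a, 'm) rack_scheme \<Rightarrow> ('i \<Rightarrow> 'a) \<Rightarrow> 'a \<Rightarrow> ('i \<times> bool) list \<Rightarrow> 'a" where
  "rack_act R \<rho> = foldl (\<lambda>t (i, e). rack_op R e t (\<rho> i))"

lemma rack_act_simps [simp]:
  "rack_act R \<rho> t [] = t"
  "rack_act R \<rho> t ((i, e) # w) = rack_act R \<rho> (rack_op R e t (\<rho> i)) w"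
  "rack_act R \<rho> t (u @ v) = rack_act R \<rho> (rack_act R \<rho> t u) v"
  by (simp_all add: rack_act_def)

lemma rack_act_hom:
  assumes "rack R" and h: "h \<in> rack_hom R T" and \<rho>: "\<rho> \<in> I \<rightarrow> carrier R"
    and "t \<in> carrier R" "fst ` set w \<subseteq> I"
  shows "h (rack_act R \<rho> t w) = rack_act T (h \<circ> \<rho>) (h t) w"
  using assms(4,5)
proof (induction w arbitrary: t)
  case (Cons l w)
  then show ?case
    using \<rho> rack.rack_op_closed[OF \<open>rack R\<close>] by (cases l) (auto simp: rack_hom_op[OF h] Pi_iff)
qed simp

section \<open>The action of the free group on a rack\<close>

context rack
begin

context
  fixes \<rho> :: "'i \<Rightarrow> 'a" and I :: "'i set"
  assumes \<rho>: "\<rho> \<in> I \<rightarrow> carrier R"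
begin

lemma rack_act_closed:
  "\<lbrakk>t \<in> carrier R; fst ` set w \<subseteq> I\<rbrakk> \<Longrightarrow> rack_act R \<rho> t w \<in> carrier R"
  using \<rho> by (induction w arbitrary: t) (auto simp: rack_op_closed Pi_iff)

text \<open>Each letter acts by an endomorphism, by \<open>rack_op_distrib\<close>, and
  endomorphisms compose.\<close>

lemma rack_act_op:
  "\<lbrakk>x \<in> carrier R; y \<in> carrier R; fst ` set w \<subseteq> I\<rbrakk> \<Longrightarrow>
    rack_act R \<rho> (rack_op R e x y) w = rack_op R e (rack_act R \<rho> x w) (rack_act R \<rho> y w)"
proof (induction w arbitrary: x y)
  case (Cons l w)
  obtain i e' where "l = (i, e')" by (cases l)
  moreover from this have "\<rho> i \<in> carrier R" using Cons.prems \<rho> by auto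
  ultimately show ?case
    using Cons rack_op_distrib[of x y "\<rho> i" e' e] by (simp add: rack_op_closed)
qed simp

text \<open>When \<open>push\<close> cancels, the two letters are mutually inverse and together act
  trivially by (R2). Hence the action of a word depends only on the group element it represents,
  which leads to \<open>rack_act_mult\<close>.\<close>

lemma rack_act_push:
  assumes "t \<in> carrier R" "fst l \<in> I" "fst ` set w \<subseteq> I"
  shows "rack_act R \<rho> t (push l w) = rack_act R \<rho> t (l # w)"
proof -
  obtain i e where "l = (i, e)" by (cases l)
  moreover from this have "\<rho> i \<in> carrier R" using assms \<rho> by auto
  ultimately show ?thesis
    using assms by (cases w) (auto simp: flip_def rack_op_cancel)
qed

lemma rack_act_foldr_push:
  "\<lbrakk>t \<in> carrier R; fst ` set u \<subseteq> I; fst ` set v \<subseteq> I\<rbrakk> \<Longrightarrow>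
    rack_act R \<rho> t (foldr push u v) = rack_act R \<rho> (rack_act R \<rho> t u) v"
proof (induction u arbitrary: t)
  case (Cons l u)
  obtain i e where l: "l = (i, e)" by (cases l)
  have "fst ` set (foldr push u v) \<subseteq> I"
    using Cons.prems by (intro order_trans[OF letters_foldr_push]) auto
  then show ?case
    using Cons \<rho> l by (auto simp: rack_act_push rack_op_closed Pi_iff)
qed simp

lemma rack_act_mult:
  "\<lbrakk>t \<in> carrier R; u \<in> carrier (free_group I); v \<in> carrier (free_group I)\<rbrakk> \<Longrightarrow>
    rack_act R \<rho> t (u \<otimes>\<^bsub>free_group I\<^esub> v) = rack_act R \<rho> (rack_act R \<rho> t u) v"
  by (simp add: free_group_def rack_act_foldr_push)

end

end


section \<open>Reduced words\<close>

lemma carrier_free_group: "w \<in> carrier (free_group X) \<longleftrightarrow> reduced w \<and> fst ` set w \<subseteq> X"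
  by (simp add: free_group_def)

lemma mult_free_group: "u \<otimes>\<^bsub>free_group X\<^esub> v = foldr push u v"
  by (simp add: free_group_def)

lemma one_free_group: "\<one>\<^bsub>free_group X\<^esub> = []"
  by (simp add: free_group_def)

text \<open>Reducedness constrains adjacent letters only, so reduced words can be split at, or glued
  along, a shared letter.\<close>

lemma reduced_append_Cons:
  "reduced (u @ l # w) \<longleftrightarrow> reduced (u @ [l]) \<and> reduced (l # w)"
  by (induction u rule: reduced.induct) (auto dest: reduced_tl)

lemma reduced_append: "reduced (u @ v) \<Longrightarrow> reduced u \<and> reduced v"
  by (induction u rule: reduced.induct) (auto dest: reduced_tl)

lemma foldr_push_append: "reduced (u @ v) \<Longrightarrow> foldr push u v = u @ v"
proof (induction u)
  case (Cons l u)
  then show ?case by (cases "u @ v") (auto dest: reduced_tl)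
qed simp

lemma inv_free_gen:
  assumes "b \<in> X"
  shows "inv\<^bsub>free_group X\<^esub> [(b, True)] = [(b, False)]"
proof -
  interpret group "free_group X" by (rule group_free_group)
  show ?thesis
    using assms
    by (intro inv_equality) (auto simp: carrier_free_group mult_free_group one_free_group flip_def)
qed

section \<open>Computation in the free rack\<close>

lemma carrier_FR: "(a, u) \<in> carrier (FR X) \<longleftrightarrow> a \<in> X \<and> u \<in> carrier (free_group X)"
  by (simp add: FR_def)

lemma rack_op_FR:
  assumes "b \<in> X"
  shows "rack_op (FR X) e (a, u) (b, v) = (a, u \<otimes>\<^bsub>free_group X\<^esub> inv\<^bsub>free_group X\<^esub> v
    \<otimes>\<^bsub>free_group X\<^esub> [(b, e)] \<otimes>\<^bsub>free_group X\<^esub> v)"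
  using assms by (cases e) (simp_all add: rack_op_def FR_def free_gen_def inv_free_gen)

lemma rack_op_FR_Nil:
  assumes "b \<in> X" "u \<in> carrier (free_group X)"
  shows "rack_op (FR X) e (a, u) (b, []) = (a, u \<otimes>\<^bsub>free_group X\<^esub> [(b, e)])"
proof -
  interpret group "free_group X" by (rule group_free_group)
  show ?thesis
    using assms inv_one r_one r_one[of "u \<otimes>\<^bsub>free_group X\<^esub> [(b, e)]"]
    by (simp add: rack_op_FR one_free_group carrier_free_group[of "[(b, e)]"])
qed

text \<open>The cancellation argument of Nielsen reduction. Put z = x u^-1, so that x = z u. If z
  ended in \<open>flip l\<close>, then x would end in \<open>flip l # u\<close>, because that word
  is reduced and nothing cancels. So z does not end in \<open>flip l\<close>, and z l u is reduced
  as written.\<close>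

lemma suffix_conjugate:
  assumes x: "x \<in> carrier (free_group X)" and u: "u \<in> carrier (free_group X)" and "fst l \<in> X"
    and lu: "reduced (l # u)" and flu: "reduced (flip l # u)" and not: "\<not> suffix (flip l # u) x"
  shows "suffix (l # u) (x \<otimes>\<^bsub>free_group X\<^esub> inv\<^bsub>free_group X\<^esub> u
    \<otimes>\<^bsub>free_group X\<^esub> [l] \<otimes>\<^bsub>free_group X\<^esub> u)"
proof -
  interpret group "free_group X" by (rule group_free_group)
  define z where "z = x \<otimes>\<^bsub>free_group X\<^esub> inv\<^bsub>free_group X\<^esub> u"
  have z: "z \<in> carrier (free_group X)" using x u by (simp add: z_def)
  have l: "[l] \<in> carrier (free_group X)" using assms by (simp add: carrier_free_group)
  have "x = z \<otimes>\<^bsub>free_group X\<^esub> u" using x u by (simp add: z_def m_assoc)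
  have "z = [] \<or> last z \<noteq> flip l"
  proof (rule ccontr)
    assume "\<not> ?thesis"
    then obtain y where y: "z = y @ [flip l]" by (metis append_butlast_last_id)
    have "reduced (y @ flip l # u)"
      using z flu reduced_append_Cons[of y "flip l" u] by (simp add: carrier_free_group y)
    then have "x = y @ flip l # u"
      using \<open>x = _\<close> foldr_push_append[of "y @ [flip l]" u] y by (simp add: mult_free_group)
    with not show False by (simp add: suffix_def)
  qed
  then have "reduced (z @ [l])"
  proof (cases z rule: rev_cases)
    case (snoc y m)
    then show ?thesis
      using z \<open>z = [] \<or> _\<close> reduced_append_Cons[of y m "[l]"]
      by (auto simp: carrier_free_group)
  qed simp
  then have "reduced (z @ l # u)"
    using lu reduced_append_Cons by blast
  then have "z \<otimes>\<^bsub>free_group X\<^esub> [l] \<otimes>\<^bsub>free_group X\<^esub> u = z @ l # u"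
    using z l u foldr_push_append[of z "l # u"] foldr_push_append[of "[l]" u] lu
    by (simp add: m_assoc) (simp add: mult_free_group)
  then show ?thesis by (simp add: z_def suffix_def)
qed


section \<open>The universal property\<close>

text \<open>The map out of \<open>FR I\<close> that the universal property attaches to
  \<open>\<rho>\<close>: the element \<open>(i, w)\<close> is the generator \<open>i\<close> acted
  on by \<open>w\<close>.\<close>

definition rack_extend :: "('a, 'm) rack_scheme \<Rightarrow> ('i \<Rightarrow> 'a) \<Rightarrow> 'i \<times> ('i \<times> bool) list \<Rightarrow> 'a" where
  "rack_extend R \<rho> = (\<lambda>(i, w). rack_act R \<rho> (\<rho> i) w)"

lemma rack_extend_gen [simp]: "rack_extend R \<rho> (FR_gen I i) = \<rho> i"
  by (simp add: rack_extend_def FR_gen_def one_free_group)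

lemma (in rack) rack_extend_hom:
  assumes \<rho>: "\<rho> \<in> I \<rightarrow> carrier R"
  shows "rack_extend R \<rho> \<in> rack_hom (FR I) R"
proof -
  interpret G: group "free_group I" by (rule group_free_group)
  have "rack_extend R \<rho> (rack_op (FR I) e (a, u) (b, v)) =
      rack_op R e (rack_extend R \<rho> (a, u)) (rack_extend R \<rho> (b, v))"
    if "(a, u) \<in> carrier (FR I)" "(b, v) \<in> carrier (FR I)" for a u b v e
  proof -
    have *: "a \<in> I" "b \<in> I" "u \<in> carrier (free_group I)" "v \<in> carrier (free_group I)"
      "[(b, e)] \<in> carrier (free_group I)"
      using that by (auto simp: carrier_FR carrier_free_group)
    have closed: "rack_act R \<rho> t w \<in> carrier R" if "t \<in> carrier R" "w \<in> carrier (free_group I)" for t w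
      using rack_act_closed[OF \<rho>] that by (simp add: carrier_free_group)
    have r: "\<rho> a \<in> carrier R" "\<rho> b \<in> carrier R" using * \<rho> by auto
    let ?t = "rack_act R \<rho> (\<rho> a) u"
    \<comment> \<open>The product has second component u v^-1 b^e v. After u and v^-1 the state is
      \<open>?s\<close>; b^e then acts on it, and the final v distributes by
      \<open>rack_act_op\<close>, restoring \<open>?t\<close> on the left and turning
      \<open>\<rho> b\<close> into the image of \<open>(b, v)\<close>.\<close>
    let ?s = "rack_act R \<rho> ?t (inv\<^bsub>free_group I\<^esub> v)"
    have "rack_act R \<rho> ?s v = ?t"
      using * r rack_act_mult[OF \<rho>, of ?t "inv\<^bsub>free_group I\<^esub> v" v]
      by (simp add: closed) (simp add: one_free_group)
    moreover have "rack_act R \<rho> (rack_op R e ?s (\<rho> b)) v =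
        rack_op R e (rack_act R \<rho> ?s v) (rack_act R \<rho> (\<rho> b) v)"
      using * r by (intro rack_act_op[OF \<rho>] closed) (auto simp: carrier_free_group[of v])
    ultimately show ?thesis
      using * r by (simp add: rack_op_FR rack_extend_def rack_act_mult[OF \<rho>] closed)
  qed
  then show ?thesis
    using \<rho> rack_act_closed[OF \<rho>]
    by (auto simp: rack_hom_iff carrier_FR rack_extend_def carrier_free_group Pi_iff)
qed

text \<open>Acting with the generators named by the letters of w builds (a, w) from (a, 1) one
  letter at a time, so the values of \<open>h\<close> on generators determine it. This is the
  uniqueness half of the universal property.\<close>

lemma rack_hom_FR_eq:
  assumes h: "h \<in> rack_hom (FR I) T" and "p \<in> carrier (FR I)"
  shows "h p = rack_extend T (\<lambda>i. h (FR_gen I i)) p"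
proof -
  have "h (a, w) = rack_act T (\<lambda>i. h (i, [])) (h (a, [])) w" if "(a, w) \<in> carrier (FR I)" for a w
    using that
  proof (induction w rule: rev_induct)
    case (snoc l w)
    obtain b e where l: "l = (b, e)" by (cases l)
    have w: "(a, w) \<in> carrier (FR I)" "b \<in> I" "w \<in> carrier (free_group I)"
      using snoc.prems reduced_append[of w "[l]"] by (auto simp: carrier_FR carrier_free_group l)
    \<comment> \<open>Since \<open>w @ [l]\<close> is reduced, multiplication by the last letter
      merely appends it.\<close>
    then have "(a, w @ [l]) = rack_op (FR I) e (a, w) (b, [])"
      using snoc.prems foldr_push_append[of w "[l]"]
      by (simp add: rack_op_FR_Nil l mult_free_group carrier_FR carrier_free_group)
    moreover have "(b, []) \<in> carrier (FR I)" using w by (simp add: carrier_FR carrier_free_group)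
    ultimately show ?case
      using w snoc.IH by (simp add: rack_hom_op[OF h] l)
  qed simp
  with \<open>p \<in> _\<close> show ?thesis
    by (cases p) (simp add: rack_extend_def FR_gen_def one_free_group)
qed

text \<open>Transport along the isomorphism with \<open>FR S\<close>: existence comes from
  \<open>rack_extend_hom\<close>, uniqueness from \<open>rack_hom_FR_eq\<close>. Homomorphisms are
  arbitrary outside the carrier, so \<open>extensional\<close> is what makes the function itself
  unique.\<close>

lemma rack_basis_universal:
  assumes "rack R" "rack_basis S R" "rack T" and \<rho>: "\<rho> \<in> S \<rightarrow> carrier T"
  shows "\<exists>!h. h \<in> rack_hom R T \<and> h \<in> extensional (carrier R) \<and> (\<forall>s\<in>S. h s = \<rho> s)"
proof -
  interpret R: rack R by fact
  obtain f where f: "f \<in> rack_iso (FR S) R" and fS: "\<And>s. s \<in> S \<Longrightarrow> f (FR_gen S s) = s"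
    and S: "S \<subseteq> carrier R"
    using \<open>rack_basis S R\<close> by (auto simp: rack_basis_def)
  define g where "g = inv_into (carrier (FR S)) f"
  have hom: "f \<in> rack_hom (FR S) R" and bij: "bij_betw f (carrier (FR S)) (carrier R)"
    using f by (auto simp: rack_iso_def)
  have g: "g \<in> rack_hom R (FR S)"
    using rack_iso_inv[OF rack_FR f] by (simp add: g_def rack_iso_def)
  have fg: "f (g x) = x" if "x \<in> carrier R" for x
    using bij_betw_inv_into_right[OF bij that] by (simp add: g_def)
  have gS: "g s = FR_gen S s" if "s \<in> S" for s
  proof -
    have "FR_gen S s \<in> carrier (FR S)"
      using that by (simp add: FR_gen_def one_free_group carrier_FR carrier_free_group)
    then show ?thesis
      using bij_betw_inv_into_left[OF bij, of "FR_gen S s"] that by (simp add: fS g_def)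
  qed
  let ?h = "restrict (rack_extend T \<rho> \<circ> g) (carrier R)"
  have "rack_extend T \<rho> \<circ> g \<in> rack_hom R T"
    using g rack.rack_extend_hom[OF \<open>rack T\<close> \<rho>] by (rule rack_hom_comp)
  then have "?h \<in> rack_hom R T"
    by (auto simp: rack_hom_iff R.rack_op_closed Pi_iff)
  moreover have "h = ?h"
    if h: "h \<in> rack_hom R T" "h \<in> extensional (carrier R)" "\<forall>s\<in>S. h s = \<rho> s" for h
  proof (rule extensionalityI[OF h(2) restrict_extensional])
    fix x assume x: "x \<in> carrier R"
    have gx: "g x \<in> carrier (FR S)" using rack_hom_closed[OF g x] .
    have "h x = (h \<circ> f) (g x)" using x by (simp add: fg)
    also have "\<dots> = rack_extend T (\<lambda>s. h (f (FR_gen S s))) (g x)"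
      using rack_hom_FR_eq[OF rack_hom_comp[OF hom h(1)] gx] by simp
    also have "\<dots> = rack_extend T \<rho> (g x)"
    proof -
      obtain a w where aw: "g x = (a, w)" by (cases "g x")
      have "rack_act T (\<lambda>s. h (f (FR_gen S s))) t w = rack_act T \<rho> t w"
        if "fst ` set w \<subseteq> S" for t w
        using that h(3) by (induction w arbitrary: t) (auto simp: fS)
      moreover have "a \<in> S" "fst ` set w \<subseteq> S"
        using gx by (auto simp: aw carrier_FR carrier_free_group)
      ultimately show ?thesis
        using h(3) by (simp add: aw rack_extend_def fS)
    qed
    finally show "h x = ?h x" using x by simp
  qed
  moreover have "?h s = \<rho> s" if "s \<in> S" for s
    using that S by (simp add: gS subset_iff)
  ultimately show ?thesis
    by (intro ex1I[of _ ?h] conjI ballI restrict_extensional) (blast | rule)+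
qed


section \<open>Irreducible elements of a subrack of a free rack\<close>

definition irreducibles :: "('a \<times> ('a \<times> bool) list) set \<Rightarrow> ('a \<times> ('a \<times> bool) list) set" where
  "irreducibles R = {(b, v) \<in> R. \<forall>(c, w) \<in> R. \<forall>e. \<not> suffix ((c, e) # w) v}"

lemma irreducibles_subset: "irreducibles R \<subseteq> R"
  by (auto simp: irreducibles_def)

lemma irreduciblesD:
  "\<lbrakk>p \<in> irreducibles R; q \<in> R\<rbrakk> \<Longrightarrow> \<not> suffix ((fst q, e) # snd q) (snd p)"
  by (auto simp: irreducibles_def)

section \<open>Generation by irreducible elements\<close>

lemma subrack_rack_op: "\<lbrakk>subrack R F; x \<in> R; y \<in> R\<rbrakk> \<Longrightarrow> rack_op F e x y \<in> R"
  by (simp add: subrack_def rack_op_def)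

text \<open>Letting \<open>M\<close> be any set closed under the operations expresses generation
  without naming a generated subrack. Later \<open>M\<close> is the image of a homomorphism, so the
  lemma gives surjectivity.\<close>

lemma irreducibles_generate:
  assumes R: "subrack R (FR X)" and M: "irreducibles R \<subseteq> M"
    and closed: "\<And>x y e. \<lbrakk>x \<in> M; y \<in> M\<rbrakk> \<Longrightarrow> rack_op (FR X) e x y \<in> M"
  shows "R \<subseteq> M"
proof -
  interpret group "free_group X" by (rule group_free_group)
  interpret FR: rack "FR X" by (rule rack_FR)
  have RF: "R \<subseteq> carrier (FR X)" using R by (simp add: subrack_def)
  have "(b, v) \<in> M" if "(b, v) \<in> R" for b v
    using that
  proof (induction "length v" arbitrary: b v rule: less_induct)
    case less
    show ?case
    proof (cases "(b, v) \<in> irreducibles R")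
      case False
      then obtain c w e y where cw: "(c, w) \<in> R" and v: "v = y @ (c, e) # w"
        using less.prems by (auto simp: irreducibles_def suffix_def)
      have carr: "c \<in> X" "w \<in> carrier (free_group X)" "v \<in> carrier (free_group X)"
        using RF cw less.prems by (auto simp: carrier_FR)
      have parts: "reduced (y @ [(c, e)])" "reduced ((c, e) # w)"
        using carr(3) reduced_append_Cons[of y "(c, e)" w] by (auto simp: carrier_free_group v)
      then have y: "y \<in> carrier (free_group X)"
        using carr(3) reduced_append[of y "[(c, e)]"] by (auto simp: carrier_free_group v)
      have ce: "[(c, e')] \<in> carrier (free_group X)" for e'
        using carr by (simp add: carrier_free_group)
      \<comment> \<open>This is v w^-1 c^-e w, the result of acting backwards on
        \<open>(b, v)\<close> with \<open>(c, w)\<close>; hence it stays in \<open>R\<close>, and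
        acting forwards recovers \<open>(b, v)\<close>.\<close>
      define v' where "v' = y \<otimes>\<^bsub>free_group X\<^esub> w"
      have "v = y \<otimes>\<^bsub>free_group X\<^esub> ([(c, e)] \<otimes>\<^bsub>free_group X\<^esub> w)"
        using carr(3) parts foldr_push_append[of y "(c, e) # w"] foldr_push_append[of "[(c, e)]" w]
        by (simp add: mult_free_group v carrier_free_group)
      then have "rack_op (FR X) e (b, v') (c, w) = (b, v)"
        using carr y ce by (simp add: rack_op_FR v'_def m_assoc)
      moreover have "(b, v') \<in> carrier (FR X)" "(c, w) \<in> carrier (FR X)"
        using less.prems RF carr y by (auto simp: carrier_FR v'_def)
      ultimately have "rack_op (FR X) (\<not> e) (b, v) (c, w) = (b, v')"
        using FR.rack_op_cancel[of "(b, v')" "(c, w)" e "\<not> e"]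
          FR.rack_op_cancel[of "(b, v')" "(c, w)" "\<not> e" e] by simp
      then have "(b, v') \<in> R"
        using subrack_rack_op[OF R less.prems cw, of "\<not> e"] by simp
      \<comment> \<open>Free reduction never lengthens a product, and the letter
        \<open>(c, e)\<close> is gone.\<close>
      moreover have "length v' < length v"
      proof -
        have "length (push l u) \<le> Suc (length u)" for l and u :: "('a \<times> bool) list"
          by (cases u) auto
        then have "length (foldr push u w) \<le> length u + length w" for u :: "('a \<times> bool) list"
          by (induction u) (auto intro: order_trans)
        then show ?thesis by (simp add: v'_def v mult_free_group le_imp_less_Suc)
      qed
      ultimately have "(b, v') \<in> M" "(c, w) \<in> M"
        using less.hyps cw by (auto simp: v)
      then show ?thesis
        using closed[of "(b, v')" "(c, w)" e] \<open>rack_op _ e _ _ = _\<close> by simp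
    qed (use M in blast)
  qed
  then show ?thesis by auto
qed

text \<open>If v = b^e' v', then \<open>(b, v)\<close> acting on itself with exponent opposite to e'
  gives v v^-1 b^-e' v = v'. So \<open>(b, v')\<close> lies in \<open>R\<close>, and v, being a
  suffix of itself, has the forbidden form. Both signs \<open>e\<close> are needed to apply
  \<open>suffix_conjugate\<close>.\<close>

lemma reduced_Cons_irreducible:
  assumes R: "subrack R (FR X)" and p: "(b, v) \<in> irreducibles R"
  shows "reduced ((b, e) # v)"
proof (cases v)
  case (Cons l v')
  interpret group "free_group X" by (rule group_free_group)
  have pR: "(b, v) \<in> R" using p by (simp add: irreducibles_def)
  then have carr: "b \<in> X" "v \<in> carrier (free_group X)"
    using R by (auto simp: subrack_def carrier_FR)
  have "l \<noteq> (b, e')" for e'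
  proof
    assume l: "l = (b, e')"
    have "[(b, \<not> e')] \<in> carrier (free_group X)" using carr by (simp add: carrier_free_group)
    then have "rack_op (FR X) (\<not> e') (b, v) (b, v) = (b, v')"
      using carr by (simp add: rack_op_FR) (simp add: mult_free_group Cons l flip_def)
    then have "(b, v') \<in> R" using subrack_rack_op[OF R pR pR, of "\<not> e'"] by simp
    then show False
      using irreduciblesD[OF p, of "(b, v')" e'] by (simp add: Cons l)
  qed
  then show ?thesis
    using carr by (simp add: Cons carrier_free_group flip_def)
qed simp

section \<open>Free generation by irreducible elements\<close>

context
  fixes X :: "'a set" and R :: "('a \<times> ('a \<times> bool) list) set"
    and \<rho> :: "'i \<Rightarrow> 'a \<times> ('a \<times> bool) list" and I :: "'i set"
  assumes R: "subrack R (FR X)"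
    and inj: "inj_on \<rho> I" and \<rho>: "\<rho> \<in> I \<rightarrow> irreducibles R"
begin

lemma rho_in: "i \<in> I \<Longrightarrow> \<rho> i \<in> R"
  using \<rho> irreducibles_subset by blast

lemma rho_FR: "\<rho> \<in> I \<rightarrow> carrier (FR X)"
  using rho_in R by (auto simp: subrack_def)

text \<open>Induction on the word from its right end. The last letter leaves its mark unless the
  state before it ends in the opposite mark. At the start irreducibility of \<open>\<rho> s\<close>
  excludes that; later the mark of the preceding letter does.\<close>

lemma suffix_rack_act:
  assumes "s \<in> I" "reduced (w @ [(i, e)])" "fst ` set (w @ [(i, e)]) \<subseteq> I"
  shows "suffix ((fst (\<rho> i), e) # snd (\<rho> i)) (snd (rack_act (FR X) \<rho> (\<rho> s) (w @ [(i, e)])))"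
  using assms(2,3)
proof (induction w arbitrary: i e rule: rev_induct)
  \<comment> \<open>An instance of \<open>suffix_conjugate\<close>, with the letter
    \<open>(fst (\<rho> i), e)\<close> for \<open>l\<close> and \<open>snd (\<rho> i)\<close> for
    \<open>u\<close>.\<close>
  have step: "suffix ((fst (\<rho> i), e) # snd (\<rho> i)) (snd (rack_op (FR X) e x (\<rho> i)))"
    if x: "x \<in> carrier (FR X)" and i: "i \<in> I"
      and "\<not> suffix ((fst (\<rho> i), \<not> e) # snd (\<rho> i)) (snd x)" for x i e
  proof -
    obtain b v where bv: "\<rho> i = (b, v)" by (cases "\<rho> i")
    have "b \<in> X" "v \<in> carrier (free_group X)"
      using rho_FR i bv by (auto simp: Pi_iff carrier_FR dest!: bspec)
    moreover have "reduced ((b, e) # v)" for e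
      using \<rho> i bv by (intro reduced_Cons_irreducible[OF R]) (auto simp: Pi_iff dest!: bspec)
    ultimately show ?thesis
      using that(1,3) by (cases x) (simp add: bv rack_op_FR carrier_FR suffix_conjugate flip_def)
  qed
  {
    case Nil
    then show ?case
      using \<open>s \<in> I\<close> rho_FR rho_in \<rho> irreduciblesD[of "\<rho> s" R "\<rho> i" "\<not> e"] step[of "\<rho> s" i e] by auto
  next
    case (snoc l w)
    obtain j f where l: "l = (j, f)" by (cases l)
    let ?x = "rack_act (FR X) \<rho> (\<rho> s) (w @ [l])"
    have I: "i \<in> I" "j \<in> I" and rw: "reduced (w @ [l])" and "fst ` set (w @ [l]) \<subseteq> I"
      and ij: "(i, e) \<noteq> flip l"
      using snoc.prems reduced_append_Cons[of w l "[(i, e)]"] by (auto simp: l)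
    then have suff: "suffix ((fst (\<rho> j), f) # snd (\<rho> j)) (snd ?x)"
      using snoc.IH[of j f] by (simp add: l)
    have "\<not> suffix ((fst (\<rho> i), \<not> e) # snd (\<rho> i)) (snd ?x)"
    proof
      \<comment> \<open>Two suffixes of one word are comparable. If one were proper in the other, it
        would be a forbidden suffix of an irreducible word; so they coincide, and injectivity of
        \<open>\<rho>\<close> makes the two adjacent letters mutually inverse.\<close>
      assume "suffix ((fst (\<rho> i), \<not> e) # snd (\<rho> i)) (snd ?x)"
      with suff consider "suffix ((fst (\<rho> i), \<not> e) # snd (\<rho> i)) ((fst (\<rho> j), f) # snd (\<rho> j))"
        | "suffix ((fst (\<rho> j), f) # snd (\<rho> j)) ((fst (\<rho> i), \<not> e) # snd (\<rho> i))"
        using suffix_same_cases by blast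
      then have "(fst (\<rho> i), \<not> e) # snd (\<rho> i) = (fst (\<rho> j), f) # snd (\<rho> j)"
      proof cases
        case 1
        moreover have "\<not> suffix ((fst (\<rho> i), \<not> e) # snd (\<rho> i)) (snd (\<rho> j))"
          using I \<rho> rho_in by (intro irreduciblesD) auto
        ultimately show ?thesis by (simp add: suffix_Cons)
      next
        case 2
        moreover have "\<not> suffix ((fst (\<rho> j), f) # snd (\<rho> j)) (snd (\<rho> i))"
          using I \<rho> rho_in by (intro irreduciblesD) auto
        ultimately show ?thesis by (simp add: suffix_Cons)
      qed
      then have "i = j" "f = (\<not> e)"
        using inj I by (auto simp: inj_on_def prod_eq_iff)
      then show False using ij by (simp add: l flip_def)
    qed
    moreover have "?x \<in> carrier (FR X)"
      using rack.rack_act_closed[OF rack_FR rho_FR] rho_FR \<open>s \<in> I\<close> \<open>fst ` set (w @ [l]) \<subseteq> I\<close>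
      by blast
    ultimately show ?case
      using step[of ?x i e] I by (simp del: append_assoc add: rack_act_simps(3)[of _ _ _ "w @ [l]"])
  }
qed

text \<open>If (s, u) and (t, v) have the same image, then u v^-1 carries \<open>\<rho> s\<close> to
  \<open>\<rho> t\<close>. A nonempty u v^-1 would give \<open>\<rho> t\<close> a forbidden suffix
  by \<open>suffix_rack_act\<close>; hence u = v, and then s = t.\<close>

lemma inj_on_rack_extend: "inj_on (rack_extend (FR X) \<rho>) (carrier (FR I))"
proof (rule inj_onI)
  interpret G: group "free_group I" by (rule group_free_group)
  interpret FR: rack "FR X" by (rule rack_FR)
  fix p q assume p: "p \<in> carrier (FR I)" and q: "q \<in> carrier (FR I)"
    and eq: "rack_extend (FR X) \<rho> p = rack_extend (FR X) \<rho> q"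
  obtain s u t v where pq: "p = (s, u)" "q = (t, v)" by (cases p, cases q)
  have carr: "s \<in> I" "t \<in> I" "u \<in> carrier (free_group I)" "v \<in> carrier (free_group I)"
    using p q by (auto simp: pq carrier_FR)
  have \<rho>st: "\<rho> s \<in> carrier (FR X)" "\<rho> t \<in> carrier (FR X)" using carr rho_FR by auto
  let ?w = "u \<otimes>\<^bsub>free_group I\<^esub> inv\<^bsub>free_group I\<^esub> v"
  have w: "?w \<in> carrier (free_group I)" using carr by simp
  have "rack_act (FR X) \<rho> (\<rho> s) ?w =
      rack_act (FR X) \<rho> (rack_extend (FR X) \<rho> p) (inv\<^bsub>free_group I\<^esub> v)"
    using carr \<rho>st by (simp add: pq rack_extend_def FR.rack_act_mult[OF rho_FR])
  also have "\<dots> = rack_act (FR X) \<rho> (\<rho> t) (v \<otimes>\<^bsub>free_group I\<^esub> inv\<^bsub>free_group I\<^esub> v)"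
    unfolding eq using carr \<rho>st
    by (subst FR.rack_act_mult[OF rho_FR]) (simp_all add: pq rack_extend_def)
  also have "\<dots> = \<rho> t"
    using carr by (simp add: one_free_group)
  finally have act: "rack_act (FR X) \<rho> (\<rho> s) ?w = \<rho> t" .
  have "?w = []"
  proof (cases ?w rule: rev_cases)
    case (snoc w l)
    obtain i e where l: "l = (i, e)" by (cases l)
    have "suffix ((fst (\<rho> i), e) # snd (\<rho> i)) (snd (\<rho> t))"
      using suffix_rack_act[of s w i e] w carr act by (simp add: snoc l carrier_free_group)
    moreover have "i \<in> I" using w by (simp add: snoc l carrier_free_group)
    ultimately show ?thesis
      using irreduciblesD[of "\<rho> t" R "\<rho> i" e] carr \<rho> rho_in by auto
  qed
  then have "\<rho> s = \<rho> t" using act by simp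
  then have "s = t" using inj carr by (auto dest: inj_onD)
  have "?w = \<one>\<^bsub>free_group I\<^esub>" using \<open>?w = []\<close> by (simp add: one_free_group)
  then have "u = v" using carr G.inv_equality[of u "inv\<^bsub>free_group I\<^esub> v"] by simp
  with \<open>s = t\<close> show "p = q" by (simp add: pq)
qed

end

section \<open>Transport to subracks of a rack isomorphic to \<open>FR X\<close>\<close>

theorem mainTheorem1:
  fixes X :: "'a set" and F :: "'b rack" and R :: "'b set"
  assumes "rack F"
    and "\<exists>f. f \<in> rack_iso (FR X) F"
    and "subrack R F"
  shows "\<exists>S\<subseteq>R. rack_basis S (F\<lparr>carrier := R\<rparr>) \<and>
    (\<forall>(T :: 'c rack) \<rho>. rack T \<longrightarrow> \<rho> \<in> S \<rightarrow> carrier T \<longrightarrow>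
      (\<exists>!h. h \<in> rack_hom (F\<lparr>carrier := R\<rparr>) T \<and> h \<in> extensional R \<and> (\<forall>s\<in>S. h s = \<rho> s)))"
proof -
  interpret F: rack F by fact
  obtain f where f: "f \<in> rack_iso (FR X) F" using assms(2) by blast
  define g where "g = inv_into (carrier (FR X)) f"
  have g_iso: "g \<in> rack_iso F (FR X)" using rack_iso_inv[OF rack_FR f] by (simp add: g_def)
  then have g: "g \<in> rack_hom F (FR X)" and g_inj: "inj_on g (carrier F)"
    by (auto simp: rack_iso_def bij_betw_def)
  let ?Q = "F\<lparr>carrier := R\<rparr>"
  have RF: "R \<subseteq> carrier F" using \<open>subrack R F\<close> by (simp add: subrack_def)
  have gR_inj: "inj_on g R" using g_inj RF by (rule inj_on_subset)
  have Q: "rack ?Q" using \<open>subrack R F\<close> by (rule F.rack_subrack)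
  have op_Q: "rack_op ?Q = rack_op F" by (simp add: rack_op_def fun_eq_iff)
  have gQ: "g \<in> rack_hom ?Q (FR X)"
    using g RF by (auto simp: rack_hom_iff op_Q Pi_iff subset_iff)
  have sub: "subrack (g ` R) (FR X)"
  proof -
    have "rack_op (FR X) e (g x) (g y) \<in> g ` R" if "x \<in> R" "y \<in> R" for x y e
      using that rack_hom_op[OF gQ, of x y e] rack.rack_op_closed[OF Q, of x y e] by force
    from this[where e = True] this[where e = False] show ?thesis
      using rack_hom_closed[OF gQ] by (auto simp: subrack_def rack_op_def)
  qed
  \<comment> \<open>Irreducibility is a property of words, so the basis is pulled back along
    \<open>g\<close> from the irreducible elements of the image of \<open>R\<close>.\<close>
  define S where "S = {r \<in> R. g r \<in> irreducibles (g ` R)}"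
  have S: "S \<subseteq> R" by (auto simp: S_def)
  \<comment> \<open>The homomorphism from \<open>FR S\<close> extending the inclusion of
    \<open>S\<close>. Followed by \<open>g\<close> it becomes the extension of \<open>g\<close> on
    \<open>S\<close>, whose injectivity is known and passes back to \<open>h\<close>.\<close>
  define h where "h = rack_extend ?Q id"
  have id: "id \<in> S \<rightarrow> carrier ?Q" using S by auto
  have h: "h \<in> rack_hom (FR S) ?Q"
    unfolding h_def using id by (rule rack.rack_extend_hom[OF Q])
  have gh: "g (h p) = rack_extend (FR X) g p" if "p \<in> carrier (FR S)" for p
    using that S rack_act_hom[OF Q gQ id]
    by (cases p) (auto simp: h_def rack_extend_def carrier_FR carrier_free_group)
  have gS: "g \<in> S \<rightarrow> irreducibles (g ` R)" by (simp add: S_def)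
  have "inj_on (rack_extend (FR X) g) (carrier (FR S))"
    using sub inj_on_subset[OF gR_inj S] gS by (rule inj_on_rack_extend)
  then have h_inj: "inj_on h (carrier (FR S))"
    using gh by (metis (no_types, lifting) inj_on_def)
  have h_gen: "h (FR_gen S s) = s" for s by (simp add: h_def)
  \<comment> \<open>The image of the homomorphism \<open>g \<circ> h\<close> is closed under both
    operations and contains the irreducible elements as images of generators.\<close>
  have "g ` R \<subseteq> g ` h ` carrier (FR S)"
  proof (rule irreducibles_generate[OF sub])
    show "irreducibles (g ` R) \<subseteq> g ` h ` carrier (FR S)"
    proof
      fix p assume p: "p \<in> irreducibles (g ` R)"
      then obtain r where r: "p = g r" "r \<in> R" by (auto simp: irreducibles_def)
      then have "r \<in> S" using p by (simp add: S_def)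
      then have "FR_gen S r \<in> carrier (FR S)"
        by (simp add: FR_gen_def one_free_group carrier_FR carrier_free_group)
      then show "p \<in> g ` h ` carrier (FR S)"
        using r h_gen by (metis imageI)
    qed
    have "rack_op (FR X) e (g (h p)) (g (h q)) \<in> g ` h ` carrier (FR S)"
      if "p \<in> carrier (FR S)" "q \<in> carrier (FR S)" for p q e
      using that rack_hom_op[OF rack_hom_comp[OF h gQ], of p q e]
        rack.rack_op_closed[OF rack_FR, of p S q e] by force
    then show "rack_op (FR X) e x y \<in> g ` h ` carrier (FR S)"
      if "x \<in> g ` h ` carrier (FR S)" "y \<in> g ` h ` carrier (FR S)" for x y e
      using that by blast
  qed
  moreover have hR: "h ` carrier (FR S) \<subseteq> R" using rack_hom_closed[OF h] by auto
  \<comment> \<open>The two sets have equal images under \<open>g\<close>, which is injective on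
    \<open>R\<close>.\<close>
  ultimately have "h ` carrier (FR S) = R"
    using inj_on_image_eq_iff[OF gR_inj, of "h ` carrier (FR S)" R] by blast
  then have "h \<in> rack_iso (FR S) ?Q"
    using h h_inj by (simp add: rack_iso_def bij_betw_def)
  then have basis: "rack_basis S ?Q"
    using S h_gen by (auto simp: rack_basis_def)
  have "\<exists>!k. k \<in> rack_hom ?Q T \<and> k \<in> extensional R \<and> (\<forall>s\<in>S. k s = \<rho> s)"
    if "rack T" "\<rho> \<in> S \<rightarrow> carrier T" for T :: "'c rack" and \<rho>
    using rack_basis_universal[OF Q basis that] by simp
  then show ?thesis
    using S basis by blast
qed

end
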